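(* Let $X\subset\mathbb{R}^d$ and $Y\subset\mathbb{R}$ be non-empty closed sets. Let $L:Y\times\mathbb{R}\to[0,\infty)$ be a convex loss function of some type $(a,p)$, with constant $c>0$ in the type inequality, and let $\mathrm{P}$ and $\tilde{\mathrm{P}}$ be probability distributions on $X\times Y$ with $|\mathrm{P}|_a<\infty$ and $|\tilde{\mathrm{P}}|_a<\infty$. Let $H$ be the RKHS of a bounded, continuous kernel $k$ on $X$. For $\lambda>0$ put $\delta_{\mathrm{P},\lambda}:=\sqrt{\mathcal{R}_{L,\mathrm{P}}(0)/\lambda}$. Then for all $\lambda>0$ with $\delta_{\mathrm{P},\lambda}>0$ and all $\varepsilon\in(0,1]$ we have $$\|f_{(1-\varepsilon)\mathrm{P}+\varepsilon\tilde{\mathrm{P}},\lambda}-f_{\mathrm{P},\lambda}\|_H\le 2c\,[\lambda\delta_{\mathrm{P},\lambda}]^{-1}\,\varepsilon\,\big(|\mathrm{P}|_a+|\tilde{\mathrm{P}}|_a+2^{p+1}\delta_{\mathrm{P},\lambda}^p\|k\|_\infty^p+2\big).$$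
   Context: A loss function is a measurable $L:Y\times\mathbb{R}\to[0,\infty)$; it is convex if $L(y,\cdot)$ is convex for every $y\in Y$. For a measurable $a:Y\to[0,\infty)$ and $p\in[0,\infty)$, $L$ is of type $(a,p)$ if there is a constant $c>0$ with $L(y,t)\le c(a(y)+|t|^p+1)$ for all $y\in Y$, $t\in\mathbb{R}$. $|\mathrm{P}|_a:=\int_{X\times Y}a(y)\,d\mathrm{P}(x,y)$, and $\mathcal{R}_{L,\mathrm{P}}(f):=\mathbb{E}_{\mathrm{P}}L(Y,f(X))$ for measurable $f:X\to\mathbb{R}$. A kernel $k:X\times X\to\mathbb{R}$ is bounded if $\|k\|_\infty:=\sup_{x\in X}\sqrt{k(x,x)}<\infty$. For a distribution $\mathrm{Q}$ on $X\times Y$ with $|\mathrm{Q}|_a<\infty$ and $\lambda>0$, $f_{\mathrm{Q},\lambda}\in H$ denotes the minimizer (which exists and is unique) over $f\in H$ of $\mathbb{E}_{\mathrm{Q}}L(Y,f(X))+\lambda\|f\|_H^2$. *)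

theory Defs
  imports "HOL-Probability.Probability"
begin

text \<open>The power $t^p$ for $t \ge 0$ and $p \ge 0$ with the convention $0^0 = 1$; the
  library's \<^const>\<open>powr\<close> has \<open>0 powr 0 = 0\<close>.\<close>

definition rpow :: "real \<Rightarrow> real \<Rightarrow> real" where
  "rpow t p = (if p = 0 then 1 else t powr p)"

definition loss_function :: "real set \<Rightarrow> (real \<Rightarrow> real \<Rightarrow> real) \<Rightarrow> bool" where
  "loss_function Y L \<longleftrightarrow>
     (\<lambda>(y, t). L y t) \<in> borel_measurable (restrict_space borel Y \<Otimes>\<^sub>M borel) \<and>
     (\<forall>y\<in>Y. \<forall>t. 0 \<le> L y t)"

definition convex_loss :: "real set \<Rightarrow> (real \<Rightarrow> real \<Rightarrow> real) \<Rightarrow> bool" where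
  "convex_loss Y L \<longleftrightarrow> loss_function Y L \<and> (\<forall>y\<in>Y. convex_on UNIV (L y))"

definition loss_of_type ::
    "real set \<Rightarrow> (real \<Rightarrow> real \<Rightarrow> real) \<Rightarrow> (real \<Rightarrow> real) \<Rightarrow> real \<Rightarrow> real \<Rightarrow> bool" where
  "loss_of_type Y L a p c \<longleftrightarrow>
     a \<in> borel_measurable (restrict_space borel Y) \<and> (\<forall>y\<in>Y. 0 \<le> a y) \<and>
     0 \<le> p \<and> 0 < c \<and>
     (\<forall>y\<in>Y. \<forall>t. L y t \<le> c * (a y + rpow \<bar>t\<bar> p + 1))"

definition distribution_on ::
    "'x::topological_space set \<Rightarrow> real set \<Rightarrow> ('x \<times> real) measure \<Rightarrow> bool" where
  "distribution_on X Y P \<longleftrightarrow>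
     prob_space P \<and> sets P = sets (restrict_space borel X \<Otimes>\<^sub>M restrict_space borel Y)"

definition abs_moment :: "(real \<Rightarrow> real) \<Rightarrow> ('x \<times> real) measure \<Rightarrow> ennreal" where
  "abs_moment a P = (\<integral>\<^sup>+ (x, y). ennreal (a y) \<partial>P)"

definition risk ::
    "(real \<Rightarrow> real \<Rightarrow> real) \<Rightarrow> ('x \<times> real) measure \<Rightarrow> ('x \<Rightarrow> real) \<Rightarrow> ennreal" where
  "risk L P f = (\<integral>\<^sup>+ (x, y). ennreal (L y (f x)) \<partial>P)"

text \<open>The convex combination $(1-\varepsilon) P + \varepsilon Q$ of two measures on the same
  measurable space.\<close>

definition mixture :: "real \<Rightarrow> 'z measure \<Rightarrow> 'z measure \<Rightarrow> 'z measure" where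
  "mixture \<epsilon> P Q = measure_of (space P) (sets P)
     (\<lambda>A. ennreal (1 - \<epsilon>) * emeasure P A + ennreal \<epsilon> * emeasure Q A)"

lemma emeasure_mixture:
  assumes "sets P = sets Q" "A \<in> sets P"
  shows "emeasure (mixture \<epsilon> P Q) A = ennreal (1 - \<epsilon>) * emeasure P A + ennreal \<epsilon> * emeasure Q A"
  unfolding mixture_def
proof (rule emeasure_measure_of_sigma)
  show "sigma_algebra (space P) (sets P)" by (rule sets.sigma_algebra_axioms)
  show "positive (sets P) (\<lambda>A. ennreal (1 - \<epsilon>) * emeasure P A + ennreal \<epsilon> * emeasure Q A)"
    by (simp add: positive_def)
  show "countably_additive (sets P)
      (\<lambda>A. ennreal (1 - \<epsilon>) * emeasure P A + ennreal \<epsilon> * emeasure Q A)"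
  proof (rule countably_additiveI)
    fix A :: "nat \<Rightarrow> _" assume "range A \<subseteq> sets P" "disjoint_family A"
    with assms(1) show "(\<Sum>i. ennreal (1 - \<epsilon>) * emeasure P (A i) + ennreal \<epsilon> * emeasure Q (A i))
        = ennreal (1 - \<epsilon>) * emeasure P (\<Union>i. A i) + ennreal \<epsilon> * emeasure Q (\<Union>i. A i)"
      by (simp add: suminf_emeasure suminf_add[symmetric])
  qed
qed fact

definition kernel_on :: "'x set \<Rightarrow> ('x \<Rightarrow> 'x \<Rightarrow> real) \<Rightarrow> bool" where
  "kernel_on X k \<longleftrightarrow>
     (\<forall>x\<in>X. \<forall>x'\<in>X. k x x' = k x' x) \<and>
     (\<forall>S \<alpha>. finite S \<and> S \<subseteq> X \<longrightarrow> 0 \<le> (\<Sum>x\<in>S. \<Sum>x'\<in>S. \<alpha> x * \<alpha> x' * k x x'))"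

definition bounded_kernel :: "'x set \<Rightarrow> ('x \<Rightarrow> 'x \<Rightarrow> real) \<Rightarrow> bool" where
  "bounded_kernel X k \<longleftrightarrow> bdd_above ((\<lambda>x. sqrt (k x x)) ` X)"

definition kernel_norm :: "'x set \<Rightarrow> ('x \<Rightarrow> 'x \<Rightarrow> real) \<Rightarrow> real" where
  "kernel_norm X k = (SUP x\<in>X. sqrt (k x x))"

definition hnorm :: "(('x \<Rightarrow> real) \<Rightarrow> ('x \<Rightarrow> real) \<Rightarrow> real) \<Rightarrow> ('x \<Rightarrow> real) \<Rightarrow> real" where
  "hnorm ip f = sqrt (ip f f)"

text \<open>A real Hilbert space \<open>H\<close> of functions on \<open>X\<close> with pointwise vector space operations and
  inner product \<open>ip\<close>. Functions on \<open>X\<close> are represented by total functions that vanish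
  outside \<open>X\<close>, so that equality of elements of \<open>H\<close> is equality on \<open>X\<close>.\<close>

locale hilbert_function_space =
  fixes X :: "'x set"
    and H :: "('x \<Rightarrow> real) set"
    and ip :: "('x \<Rightarrow> real) \<Rightarrow> ('x \<Rightarrow> real) \<Rightarrow> real"
  assumes vanish: "f \<in> H \<Longrightarrow> x \<notin> X \<Longrightarrow> f x = 0"
    and zero_mem: "(\<lambda>_. 0) \<in> H"
    and add_mem: "f \<in> H \<Longrightarrow> g \<in> H \<Longrightarrow> (\<lambda>x. f x + g x) \<in> H"
    and scale_mem: "f \<in> H \<Longrightarrow> (\<lambda>x. r * f x) \<in> H"
    and ip_commute: "f \<in> H \<Longrightarrow> g \<in> H \<Longrightarrow> ip f g = ip g f"
    and ip_add_left: "f \<in> H \<Longrightarrow> g \<in> H \<Longrightarrow> h \<in> H \<Longrightarrow> ip (\<lambda>x. f x + g x) h = ip f h + ip g h"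
    and ip_scale_left: "f \<in> H \<Longrightarrow> g \<in> H \<Longrightarrow> ip (\<lambda>x. r * f x) g = r * ip f g"
    and ip_nonneg: "f \<in> H \<Longrightarrow> 0 \<le> ip f f"
    and ip_definite: "f \<in> H \<Longrightarrow> ip f f = 0 \<Longrightarrow> f = (\<lambda>_. 0)"
    and complete:
      "(\<And>n::nat. F n \<in> H) \<Longrightarrow>
       (\<And>e::real. e > 0 \<Longrightarrow> \<exists>N. \<forall>m\<ge>N. \<forall>n\<ge>N. hnorm ip (\<lambda>x. F m x - F n x) < e) \<Longrightarrow>
       \<exists>f\<in>H. (\<lambda>n. hnorm ip (\<lambda>x. F n x - f x)) \<longlonglongrightarrow> 0"

definition kernel_section :: "'x set \<Rightarrow> ('x \<Rightarrow> 'x \<Rightarrow> real) \<Rightarrow> 'x \<Rightarrow> 'x \<Rightarrow> real" where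
  "kernel_section X k x = (\<lambda>x'. if x' \<in> X then k x x' else 0)"

locale rkhs = hilbert_function_space X H ip
  for X :: "'x set" and k :: "'x \<Rightarrow> 'x \<Rightarrow> real" and H :: "('x \<Rightarrow> real) set"
    and ip :: "('x \<Rightarrow> real) \<Rightarrow> ('x \<Rightarrow> real) \<Rightarrow> real" +
  assumes section_mem: "x \<in> X \<Longrightarrow> kernel_section X k x \<in> H"
    and reproducing: "f \<in> H \<Longrightarrow> x \<in> X \<Longrightarrow> ip f (kernel_section X k x) = f x"

definition reg_risk ::
    "(real \<Rightarrow> real \<Rightarrow> real) \<Rightarrow> (('x \<Rightarrow> real) \<Rightarrow> ('x \<Rightarrow> real) \<Rightarrow> real) \<Rightarrow> ('x \<times> real) measure \<Rightarrow> real
      \<Rightarrow> ('x \<Rightarrow> real) \<Rightarrow> ennreal" where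
  "reg_risk L ip Q l f = risk L Q f + ennreal (l * (hnorm ip f)\<^sup>2)"

text \<open>The minimizer $f_{Q,\lambda}$ over \<open>H\<close>.\<close>

definition rrm_solution ::
    "(real \<Rightarrow> real \<Rightarrow> real) \<Rightarrow> ('x \<Rightarrow> real) set \<Rightarrow> (('x \<Rightarrow> real) \<Rightarrow> ('x \<Rightarrow> real) \<Rightarrow> real)
      \<Rightarrow> ('x \<times> real) measure \<Rightarrow> real \<Rightarrow> ('x \<Rightarrow> real)" where
  "rrm_solution L H ip Q l = (THE f. is_arg_min (reg_risk L ip Q l) (\<lambda>f. f \<in> H) f)"

text \<open>The number $\delta_{P,\lambda}$, an upper bound for the norm of the minimizer.\<close>

definition radius :: "(real \<Rightarrow> real \<Rightarrow> real) \<Rightarrow> ('x \<times> real) measure \<Rightarrow> real \<Rightarrow> real" where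
  "radius L P l = sqrt (enn2real (risk L P (\<lambda>_. 0)) / l)"

end

theory Submission
  imports Defs
begin

text \<open>
  Write \<open>J\<^sub>Q\<close> for the regularized risk under \<open>Q\<close>, let \<open>f\<close> and \<open>g\<close> minimize \<open>J\<^sub>P\<close> and \<open>J\<^sub>M\<close>, where \<open>M\<close> is
  the mixture, and let \<open>d = \<parallel>g - f\<parallel>\<close>. The midpoint (parallelogram) inequality gives
  \<open>J\<^sub>P g \<ge> J\<^sub>P f + l d^2 / 2\<close> and \<open>J\<^sub>M f \<ge> J\<^sub>M g + l d^2 / 2\<close>. Since \<open>J\<^sub>M\<close> is affine in \<open>\<epsilon>\<close>, all that is
  needed besides is a lower bound for \<open>J g - J f\<close> under the contaminating distribution. As
  \<open>\<bar>f\<bar> \<le> \<kappa> \<delta>\<close>, convexity bounds the downward slopes of the nonnegative loss at the values of \<open>f\<close> by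
  its maximum on \<open>[-2 \<kappa> \<delta>, 2 \<kappa> \<delta>]\<close> divided by \<open>\<kappa> \<delta>\<close>, no matter how large \<open>g\<close> is; so neither
  subgradients nor a representer theorem are required.
\<close>

subsection \<open>Strongly convex minimization in a Hilbert space of functions\<close>

context hilbert_function_space
begin

lemma diff_mem:
  assumes "f \<in> H" "g \<in> H"
  shows "(\<lambda>x. f x - g x) \<in> H"
  using add_mem[OF assms(1) scale_mem[OF assms(2), of "-1"]] by simp

lemma midpoint_mem:
  assumes "f \<in> H" "g \<in> H"
  shows "(\<lambda>x. (f x + g x) / 2) \<in> H"
  using scale_mem[OF add_mem[OF assms], of "1/2"] by simp

lemma ip_diff_left:
  assumes "f \<in> H" "g \<in> H" "h \<in> H"
  shows "ip (\<lambda>x. f x - g x) h = ip f h - ip g h"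
  using ip_add_left[OF assms(1) scale_mem[OF assms(2), of "-1"] assms(3)]
    ip_scale_left[OF assms(2,3), of "-1"] by simp

lemma ip_diff_right:
  assumes "f \<in> H" "g \<in> H" "h \<in> H"
  shows "ip h (\<lambda>x. f x - g x) = ip h f - ip h g"
  using ip_diff_left[OF assms] ip_commute[OF assms(3)] assms diff_mem by simp

lemma ip_add_right:
  assumes "f \<in> H" "g \<in> H" "h \<in> H"
  shows "ip h (\<lambda>x. f x + g x) = ip h f + ip h g"
  using ip_add_left[OF assms] ip_commute[OF assms(3)] assms add_mem by simp

lemma ip_scale_right:
  assumes "f \<in> H" "g \<in> H"
  shows "ip f (\<lambda>x. r * g x) = r * ip f g"
  using ip_scale_left[OF assms(2,1)] ip_commute[OF assms(1)] assms scale_mem by simp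

lemma hnorm_nonneg: "f \<in> H \<Longrightarrow> 0 \<le> hnorm ip f"
  by (simp add: hnorm_def ip_nonneg)

lemma hnorm_power2: "f \<in> H \<Longrightarrow> (hnorm ip f)\<^sup>2 = ip f f"
  by (simp add: hnorm_def ip_nonneg)

lemma hnorm_zero: "hnorm ip (\<lambda>_. 0) = 0"
  using ip_scale_left[OF zero_mem zero_mem, of 0] by (simp add: hnorm_def)

lemma hnorm_diff_power2:
  assumes "f \<in> H" "g \<in> H"
  shows "(hnorm ip (\<lambda>x. f x - g x))\<^sup>2 = ip f f - 2 * ip f g + ip g g"
  using assms ip_commute[OF assms]
  by (simp add: hnorm_power2 diff_mem ip_diff_left ip_diff_right)

text \<open>The parallelogram identity, arranged so that a quarter of the squared distance appears
  as the gain over the average. The strong convexity used below comes from this term alone.\<close>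

lemma hnorm_midpoint_power2:
  assumes "f \<in> H" "g \<in> H"
  shows "(hnorm ip (\<lambda>x. (f x + g x) / 2))\<^sup>2
    = ((hnorm ip f)\<^sup>2 + (hnorm ip g)\<^sup>2) / 2 - (hnorm ip (\<lambda>x. f x - g x))\<^sup>2 / 4"
proof -
  let ?s = "\<lambda>x. f x + g x"
  have s: "?s \<in> H" by (rule add_mem[OF assms])
  have "(hnorm ip (\<lambda>x. (f x + g x) / 2))\<^sup>2 = ip (\<lambda>x. (1/2) * ?s x) (\<lambda>x. (1/2) * ?s x)"
    using hnorm_power2[OF midpoint_mem[OF assms]] by simp
  also have "\<dots> = ip ?s ?s / 4"
    by (simp only: ip_scale_left[OF s scale_mem[OF s]] ip_scale_right[OF s s])
  also have "ip ?s ?s = ip f f + 2 * ip f g + ip g g"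
    using assms s ip_commute[OF assms] by (simp add: ip_add_left ip_add_right)
  finally show ?thesis
    using assms by (simp add: hnorm_diff_power2 hnorm_power2 field_simps)
qed

lemma Cauchy_Schwarz:
  assumes "f \<in> H" "g \<in> H"
  shows "\<bar>ip f g\<bar> \<le> hnorm ip f * hnorm ip g"
proof (cases "ip g g = 0")
  case True
  then have "g = (\<lambda>_. 0)" using ip_definite assms by blast
  then have "ip f g = 0" using ip_scale_right[OF assms(1) zero_mem, of 0] by simp
  then show ?thesis using assms hnorm_nonneg by simp
next
  case False
  then have pos: "0 < ip g g" using ip_nonneg[OF assms(2)] by linarith
  \<comment> \<open>\<open>r * g\<close> is the orthogonal projection of \<open>f\<close> onto the
    line through \<open>g\<close>; the squared norm of the residual is nonnegative.\<close>
  define r where "r = ip f g / ip g g"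
  have m: "(\<lambda>x. r * g x) \<in> H" using assms scale_mem by blast
  have "0 \<le> (hnorm ip (\<lambda>x. f x - r * g x))\<^sup>2" by simp
  also have "\<dots> = ip f f - 2 * (r * ip f g) + r * (r * ip g g)"
    using hnorm_diff_power2[OF assms(1) m] ip_scale_right[OF assms(1,2)]
      ip_scale_left[OF assms(2) m] ip_scale_right[OF assms(2,2)] by simp
  also have "\<dots> = ip f f - (ip f g)\<^sup>2 / ip g g"
    using pos by (simp add: r_def field_simps power2_eq_square)
  finally have "(ip f g)\<^sup>2 \<le> ip f f * ip g g" using pos by (simp add: field_simps)
  then have "(ip f g)\<^sup>2 \<le> (hnorm ip f * hnorm ip g)\<^sup>2"
    using assms by (simp add: power_mult_distrib hnorm_power2)
  then show ?thesis
    using assms hnorm_nonneg by (metis abs_le_square_iff abs_of_nonneg mult_nonneg_nonneg)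
qed

text \<open>After squaring, the reverse triangle inequality is Cauchy-Schwarz: the two squares
  differ by twice the gap between the product of the norms and the inner product.\<close>

lemma hnorm_diff_triangle:
  assumes "f \<in> H" "g \<in> H"
  shows "\<bar>hnorm ip f - hnorm ip g\<bar> \<le> hnorm ip (\<lambda>x. f x - g x)"
proof -
  have "(hnorm ip f - hnorm ip g)\<^sup>2 \<le> (hnorm ip (\<lambda>x. f x - g x))\<^sup>2"
    unfolding hnorm_diff_power2[OF assms] power2_diff
    using Cauchy_Schwarz[OF assms] assms by (simp add: hnorm_power2)
  then show ?thesis
    using hnorm_nonneg[OF diff_mem[OF assms]] by (metis abs_le_square_iff abs_of_nonneg)
qed

lemma hnorm_tendsto:
  assumes "\<And>n. F n \<in> H" "f \<in> H" "(\<lambda>n. hnorm ip (\<lambda>x. F n x - f x)) \<longlonglongrightarrow> 0"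
  shows "(\<lambda>n. hnorm ip (F n)) \<longlonglongrightarrow> hnorm ip f"
proof -
  have "(\<lambda>n. hnorm ip (F n) - hnorm ip f) \<longlonglongrightarrow> 0"
    by (rule Lim_null_comparison[OF _ assms(3)]) (simp add: assms hnorm_diff_triangle)
  then show ?thesis by (simp add: LIM_zero_iff)
qed

text \<open>The midpoint of \<open>f\<close> and \<open>g\<close> competes with the minimizer
  \<open>f\<close>; doubling the midpoint inequality turns its \<open>l / 4\<close> into
  \<open>l / 2\<close>.\<close>

lemma strongly_convex_minimizer_gap:
  assumes mid: "J (\<lambda>x. (f x + g x) / 2)
      \<le> (J f + J g) / 2 - l / 4 * (hnorm ip (\<lambda>x. f x - g x))\<^sup>2"
    and min: "is_arg_min J (\<lambda>f. f \<in> H) f" and "g \<in> H"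
  shows "(J f :: real) + l / 2 * (hnorm ip (\<lambda>x. f x - g x))\<^sup>2 \<le> J g"
proof -
  have "J f \<le> J (\<lambda>x. (f x + g x) / 2)"
    using min midpoint_mem \<open>g \<in> H\<close> unfolding is_arg_min_linorder by blast
  with mid show ?thesis by (simp add: field_simps)
qed

text \<open>The midpoint inequality makes every minimizing sequence Cauchy in norm. Completeness
  supplies a limit, \<open>cont\<close> shows that it attains the infimum, and the gap inequality
  gives uniqueness.\<close>

lemma strongly_convex_ex1_minimizer:
  fixes J :: "('x \<Rightarrow> real) \<Rightarrow> real"
  assumes "0 < l" and nonneg: "\<And>f. f \<in> H \<Longrightarrow> 0 \<le> J f"
    and mid: "\<And>f g. f \<in> H \<Longrightarrow> g \<in> H \<Longrightarrow> J (\<lambda>x. (f x + g x) / 2)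
      \<le> (J f + J g) / 2 - l / 4 * (hnorm ip (\<lambda>x. f x - g x))\<^sup>2"
    and cont: "\<And>F f. (\<And>n. F n \<in> H) \<Longrightarrow> f \<in> H \<Longrightarrow>
      (\<lambda>n. hnorm ip (\<lambda>x. F n x - f x)) \<longlonglongrightarrow> 0 \<Longrightarrow> (\<lambda>n. J (F n)) \<longlonglongrightarrow> J f"
  shows "\<exists>!f. is_arg_min J (\<lambda>f. f \<in> H) f"
proof -
  define m where "m = (INF f\<in>H. J f)"
  have bdd: "bdd_below (J ` H)" using nonneg by (auto intro!: bdd_belowI)
  have lower: "m \<le> J f" if "f \<in> H" for f
    unfolding m_def by (rule cINF_lower[OF bdd that])
  have "\<exists>f\<in>H. J f < m + inverse (real (Suc n))" for n
    using cINF_less_iff[OF _ bdd, of "m + inverse (real (Suc n))"] zero_mem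
    unfolding m_def by fastforce
  then obtain F where FH: "F n \<in> H" and F: "J (F n) < m + inverse (real (Suc n))" for n
    by metis
  have lim: "(\<lambda>n. J (F n)) \<longlonglongrightarrow> m"
  proof (rule tendsto_sandwich[OF _ _ tendsto_const])
    show "(\<lambda>n. m + inverse (real (Suc n))) \<longlonglongrightarrow> m"
      using tendsto_add[OF tendsto_const[of m] LIMSEQ_inverse_real_of_nat] by simp
    show "\<forall>\<^sub>F n in sequentially. m \<le> J (F n)"
      using lower[OF FH] by simp
    show "\<forall>\<^sub>F n in sequentially. J (F n) \<le> m + inverse (real (Suc n))"
      using less_imp_le[OF F] by (intro always_eventually allI)
  qed
  have "\<exists>N. \<forall>i\<ge>N. \<forall>j\<ge>N. hnorm ip (\<lambda>x. F i x - F j x) < e" if "0 < e" for e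
  proof -
    \<comment> \<open>Values within \<open>l / 4 * e\<^sup>2\<close> of the infimum suffice: two
      such iterates have an average below that level, while the value at their midpoint is at least
      \<open>m\<close>.\<close>
    have "0 < l / 4 * e\<^sup>2" using \<open>0 < l\<close> \<open>0 < e\<close> by simp
    then obtain N where N: "\<And>n. n \<ge> N \<Longrightarrow> J (F n) < m + l / 4 * e\<^sup>2"
      using order_tendstoD(2)[OF lim, of "m + l / 4 * e\<^sup>2"]
      unfolding eventually_sequentially by auto
    have "hnorm ip (\<lambda>x. F i x - F j x) < e" if "i \<ge> N" "j \<ge> N" for i j
    proof -
      have "m \<le> (J (F i) + J (F j)) / 2 - l / 4 * (hnorm ip (\<lambda>x. F i x - F j x))\<^sup>2"
        using mid[OF FH FH] lower[OF midpoint_mem[OF FH FH]] by (rule order_trans[rotated])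
      then have "l / 4 * (hnorm ip (\<lambda>x. F i x - F j x))\<^sup>2 < l / 4 * e\<^sup>2"
        using N[OF that(1)] N[OF that(2)] by argo
      then have "(hnorm ip (\<lambda>x. F i x - F j x))\<^sup>2 < e\<^sup>2" using \<open>0 < l\<close> by simp
      then show ?thesis using \<open>0 < e\<close> by (simp add: power2_less_imp_less)
    qed
    then show ?thesis by blast
  qed
  then obtain f where "f \<in> H" "(\<lambda>n. hnorm ip (\<lambda>x. F n x - f x)) \<longlonglongrightarrow> 0"
    using complete[of F] FH by blast
  then have "(\<lambda>n. J (F n)) \<longlonglongrightarrow> J f" by (rule cont[OF FH])
  then have "J f = m" using lim by (rule LIMSEQ_unique)
  then have ex: "is_arg_min J (\<lambda>f. f \<in> H) f"
    using lower \<open>f \<in> H\<close> unfolding is_arg_min_linorder by blast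
  show ?thesis
  proof (intro ex1I)
    show "is_arg_min J (\<lambda>f. f \<in> H) f" by (rule ex)
    fix g assume g: "is_arg_min J (\<lambda>f. f \<in> H) g"
    then have "g \<in> H" "J g \<le> J f" using \<open>f \<in> H\<close> unfolding is_arg_min_linorder by auto
    then have "l / 2 * (hnorm ip (\<lambda>x. f x - g x))\<^sup>2 \<le> 0"
      using strongly_convex_minimizer_gap[of J f g l, OF mid ex] \<open>f \<in> H\<close> by simp
    then have "(hnorm ip (\<lambda>x. f x - g x))\<^sup>2 = 0"
      using \<open>0 < l\<close> by (simp add: mult_le_0_iff)
    then have "(\<lambda>x. f x - g x) = (\<lambda>_. 0)"
      using ip_definite diff_mem \<open>f \<in> H\<close> \<open>g \<in> H\<close> hnorm_power2 by metis
    then show "g = f" by (simp add: fun_eq_iff)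
  qed
qed

end

subsection \<open>One-sided slope bounds and mixtures of measures\<close>

lemma rpow_mono: "0 \<le> s \<Longrightarrow> s \<le> t \<Longrightarrow> 0 \<le> p \<Longrightarrow> rpow s p \<le> rpow t p"
  by (simp add: rpow_def powr_mono2)

lemma rpow_nonneg: "0 \<le> rpow t p"
  by (simp add: rpow_def)

text \<open>Seen from \<open>t\<close>, a convex function falls towards \<open>s\<close> no faster
  than along the chord from a point on the other side of \<open>t\<close>. With that point at
  distance \<open>B\<close>, the descent per unit length is at most \<open>M / B\<close>, because
  \<open>f t\<close> is nonnegative. The point \<open>s\<close> may be arbitrarily far away.\<close>

lemma convex_on_diff_ge:
  fixes f :: "real \<Rightarrow> real"
  assumes "convex_on UNIV f" "\<And>u. 0 \<le> f u" "0 < B" "\<bar>t\<bar> \<le> B"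
    and M: "\<And>u. \<bar>u\<bar> \<le> 2 * B \<Longrightarrow> f u \<le> M"
  shows "- (M / B * \<bar>s - t\<bar>) \<le> f s - f t"
proof (cases "s = t")
  case False
  define r where "r = \<bar>s - t\<bar>"
  \<comment> \<open>\<open>u\<close> lies at distance \<open>B\<close> from \<open>t\<close> on the
    side away from \<open>s\<close>, so \<open>t\<close> is a convex combination of \<open>s\<close>
    and \<open>u\<close> with weights proportional to \<open>B\<close> and \<open>r\<close>.\<close>
  define u where "u = t - sgn (s - t) * B"
  have "0 < r" using False by (simp add: r_def)
  have "\<bar>u\<bar> \<le> 2 * B" using assms(3,4) by (auto simp: u_def sgn_if)
  have "r * u = r * t - (s - t) * B"
    using False by (auto simp: u_def r_def sgn_if algebra_simps)
  moreover have w: "1 - r / (B + r) = B / (B + r)"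
    using \<open>0 < B\<close> \<open>0 < r\<close> by (simp add: field_simps)
  ultimately have "t = (1 - r / (B + r)) *\<^sub>R s + (r / (B + r)) *\<^sub>R u"
    using \<open>0 < B\<close> \<open>0 < r\<close> by (simp add: w add_divide_distrib[symmetric]) (simp add: field_simps)
  then have "f t \<le> (1 - r / (B + r)) * f s + (r / (B + r)) * f u"
    using convex_onD[OF assms(1), of "r / (B + r)" s u] \<open>0 < B\<close> \<open>0 < r\<close> by simp
  then have "f t \<le> (B * f s + r * f u) / (B + r)"
    unfolding w by (simp add: add_divide_distrib)
  then have "B * f t + r * f t \<le> B * f s + r * f u"
    using \<open>0 < B\<close> \<open>0 < r\<close> by (simp add: pos_le_divide_eq algebra_simps)
  also have "\<dots> \<le> B * f s + r * M"
    using mult_left_mono[OF M[OF \<open>\<bar>u\<bar> \<le> 2 * B\<close>], of r] \<open>0 < r\<close> by linarith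
  finally have "- (r * M) \<le> B * (f s - f t)"
    using mult_nonneg_nonneg[OF less_imp_le[OF \<open>0 < r\<close>] assms(2)[of t]]
    unfolding right_diff_distrib by linarith
  then show ?thesis using \<open>0 < B\<close> unfolding r_def[symmetric] by (simp add: field_simps)
qed simp

section \<open>Integration against mixtures of measures\<close>

lemma sets_mixture [measurable_cong]: "sets (mixture \<epsilon> P Q) = sets P"
  by (simp add: mixture_def)

lemma space_mixture: "space (mixture \<epsilon> P Q) = space P"
  by (simp add: mixture_def)

text \<open>Induction over nonnegative measurable functions; for indicators the claim is the
  defining formula of the mixture.\<close>

lemma nn_integral_mixture:
  assumes sets: "sets P = sets Q" and "u \<in> borel_measurable P"
  shows "(\<integral>\<^sup>+z. u z \<partial>mixture \<epsilon> P Q)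
    = ennreal (1 - \<epsilon>) * (\<integral>\<^sup>+z. u z \<partial>P) + ennreal \<epsilon> * (\<integral>\<^sup>+z. u z \<partial>Q)"
proof -
  have Q: "u \<in> borel_measurable Q" if "u \<in> borel_measurable P" for u :: "'a \<Rightarrow> ennreal"
    using that measurable_cong_sets[OF sets refl] by blast
  show ?thesis
    using assms(2)
  proof (induction rule: borel_measurable_induct)
    case (cong f g)
    moreover have "space Q = space P" using sets by (rule sets_eq_imp_space_eq[symmetric])
    ultimately show ?case by (simp add: space_mixture cong: nn_integral_cong_simp)
  next
    case (set A)
    then have "A \<in> sets Q" "A \<in> sets (mixture \<epsilon> P Q)" using sets by (auto simp: sets_mixture)
    with set show ?case by (simp add: emeasure_mixture[OF sets])
  next
    case (mult u r)
    note [measurable] = mult.hyps(2) Q[OF mult.hyps(2)]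
    show ?case using mult by (simp add: nn_integral_cmult distrib_left mult.left_commute)
  next
    case (add u v)
    note [measurable] = add.hyps(1,3) Q[OF add.hyps(1)] Q[OF add.hyps(3)]
    show ?case by (simp add: nn_integral_add add.IH distrib_left add_ac)
  next
    case (seq U)
    note [measurable] = seq.hyps(1) Q[OF seq.hyps(1)]
    have inc: "incseq (\<lambda>i. \<integral>\<^sup>+z. U i z \<partial>M)" for M
      using seq.hyps(3) by (intro monoI nn_integral_mono) (simp add: mono_def le_fun_def)
    have "(\<integral>\<^sup>+z. (SUP i. U i z) \<partial>mixture \<epsilon> P Q)
        = (SUP i. ennreal (1 - \<epsilon>) * (\<integral>\<^sup>+z. U i z \<partial>P) + ennreal \<epsilon> * (\<integral>\<^sup>+z. U i z \<partial>Q))"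
      using seq.hyps(3) by (simp add: nn_integral_monotone_convergence_SUP seq.IH)
    also have "\<dots> = (SUP i. ennreal (1 - \<epsilon>) * (\<integral>\<^sup>+z. U i z \<partial>P))
        + (SUP i. ennreal \<epsilon> * (\<integral>\<^sup>+z. U i z \<partial>Q))"
      \<comment> \<open>The supremum of the sum splits because both sequences are
        increasing.\<close>
      by (intro ennreal_SUP_add monoI mult_left_mono monoD[OF inc]) auto
    also have "\<dots> = ennreal (1 - \<epsilon>) * (\<integral>\<^sup>+z. (SUP i. U i z) \<partial>P)
        + ennreal \<epsilon> * (\<integral>\<^sup>+z. (SUP i. U i z) \<partial>Q)"
      using seq.hyps(3) by (simp add: nn_integral_monotone_convergence_SUP SUP_mult_left_ennreal)
    finally show ?case by (simp add: image_comp)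
  qed
qed

text \<open>Nonnegativity of \<open>u\<close> permits a detour through the extended nonnegative
  integral; for \<open>\<epsilon>\<close> between 0 and 1 both weights survive the passage through
  \<open>ennreal\<close>.\<close>

lemma integral_mixture:
  fixes u :: "'z \<Rightarrow> real"
  assumes sets: "sets P = sets Q" and int: "integrable P u" "integrable Q u"
    and nonneg: "\<And>z. z \<in> space P \<Longrightarrow> 0 \<le> u z" and "0 \<le> \<epsilon>" "\<epsilon> \<le> 1"
  shows "(\<integral>z. u z \<partial>mixture \<epsilon> P Q) = (1 - \<epsilon>) * (\<integral>z. u z \<partial>P) + \<epsilon> * (\<integral>z. u z \<partial>Q)"
proof -
  have [measurable]: "u \<in> borel_measurable P" using int by simp
  have sp: "space Q = space P" using sets by (rule sets_eq_imp_space_eq[symmetric])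
  have nn: "0 \<le> (\<integral>z. u z \<partial>P)" "0 \<le> (\<integral>z. u z \<partial>Q)"
    by (rule integral_nonneg_AE, rule AE_I2, simp add: nonneg sp)+
  have eq: "(\<integral>\<^sup>+z. ennreal (u z) \<partial>P) = ennreal (\<integral>z. u z \<partial>P)"
    "(\<integral>\<^sup>+z. ennreal (u z) \<partial>Q) = ennreal (\<integral>z. u z \<partial>Q)"
    using nonneg int by (auto intro!: nn_integral_eq_integral AE_I2 simp: sp)
  have "(\<integral>\<^sup>+z. ennreal (u z) \<partial>mixture \<epsilon> P Q)
      = ennreal (1 - \<epsilon>) * ennreal (\<integral>z. u z \<partial>P) + ennreal \<epsilon> * ennreal (\<integral>z. u z \<partial>Q)"
    by (simp add: nn_integral_mixture[OF sets] eq)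
  also have "\<dots> = ennreal ((1 - \<epsilon>) * (\<integral>z. u z \<partial>P) + \<epsilon> * (\<integral>z. u z \<partial>Q))"
    using nn \<open>0 \<le> \<epsilon>\<close> \<open>\<epsilon> \<le> 1\<close> by (simp add: ennreal_mult)
  finally have "integral\<^sup>L (mixture \<epsilon> P Q) u
      = enn2real (ennreal ((1 - \<epsilon>) * (\<integral>z. u z \<partial>P) + \<epsilon> * (\<integral>z. u z \<partial>Q)))"
    using nonneg by (subst integral_eq_nn_integral) (auto simp: space_mixture intro!: AE_I2)
  then show ?thesis
    using nn \<open>0 \<le> \<epsilon>\<close> \<open>\<epsilon> \<le> 1\<close>
    by (simp only: enn2real_ennreal add_nonneg_nonneg mult_nonneg_nonneg diff_ge_0_iff_ge)
qed

lemma distribution_on_mixture: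
  assumes "distribution_on X Y P" "distribution_on X Y Q" "0 \<le> \<epsilon>" "\<epsilon> \<le> 1"
  shows "distribution_on X Y (mixture \<epsilon> P Q)"
proof -
  interpret P: prob_space P using assms by (simp add: distribution_on_def)
  interpret Q: prob_space Q using assms by (simp add: distribution_on_def)
  have sets: "sets P = sets Q" using assms by (simp add: distribution_on_def)
  have "emeasure (mixture \<epsilon> P Q) (space P) = ennreal (1 - \<epsilon>) + ennreal \<epsilon>"
    using emeasure_mixture[OF sets sets.top] P.emeasure_space_1 Q.emeasure_space_1
      sets_eq_imp_space_eq[OF sets] by simp
  also have "\<dots> = 1" using assms(3,4) by (simp flip: ennreal_plus)
  finally have "prob_space (mixture \<epsilon> P Q)" by (intro prob_spaceI) (simp add: space_mixture)
  then show ?thesis using assms by (simp add: distribution_on_def sets_mixture)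
qed

subsection \<open>Regularized risk over a reproducing kernel Hilbert space\<close>

text \<open>The measure is not a parameter of the locale, since the results are applied to the
  original, the contaminating and the mixed distribution.\<close>

locale kernel_risk = rkhs X k H ip
  for X :: "'x::topological_space set" and k H ip +
  fixes Y :: "real set" and L :: "real \<Rightarrow> real \<Rightarrow> real" and a :: "real \<Rightarrow> real" and p c l :: real
  assumes nonempty: "X \<noteq> {}"
    and convex_loss: "convex_loss Y L"
    and type: "loss_of_type Y L a p c"
    and bounded: "bounded_kernel X k"
    and continuous: "continuous_on (X \<times> X) (\<lambda>(x, x'). k x x')"
    and l_pos: "0 < l"
begin

abbreviation "\<kappa> \<equiv> kernel_norm X k"

definition admissible :: "('x \<times> real) measure \<Rightarrow> bool" where
  "admissible Q \<longleftrightarrow> distribution_on X Y Q \<and> abs_moment a Q < \<infinity>"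

text \<open>Real-valued counterparts of \<open>risk\<close> and \<open>reg_risk\<close>: under
  admissible measures these are finite on \<open>H\<close>, and the argument subtracts them.\<close>

definition real_risk :: "('x \<times> real) measure \<Rightarrow> ('x \<Rightarrow> real) \<Rightarrow> real" where
  "real_risk Q f = (\<integral>z. L (snd z) (f (fst z)) \<partial>Q)"

definition objective :: "('x \<times> real) measure \<Rightarrow> ('x \<Rightarrow> real) \<Rightarrow> real" where
  "objective Q f = real_risk Q f + l * (hnorm ip f)\<^sup>2"

lemma p_nonneg: "0 \<le> p" and c_pos: "0 < c"
  and a_nonneg: "y \<in> Y \<Longrightarrow> 0 \<le> a y"
  and loss_nonneg: "y \<in> Y \<Longrightarrow> 0 \<le> L y t"
  and loss_convex: "y \<in> Y \<Longrightarrow> convex_on UNIV (L y)"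
  and loss_measurable: "(\<lambda>(y, t). L y t) \<in> borel_measurable (restrict_space borel Y \<Otimes>\<^sub>M borel)"
  and a_measurable: "a \<in> borel_measurable (restrict_space borel Y)"
  using type convex_loss unfolding loss_of_type_def convex_loss_def loss_function_def by blast+

lemma loss_le:
  assumes "y \<in> Y" "\<bar>t\<bar> \<le> B"
  shows "L y t \<le> c * (a y + rpow B p + 1)"
proof -
  have "L y t \<le> c * (a y + rpow \<bar>t\<bar> p + 1)"
    using type assms by (simp add: loss_of_type_def)
  also have "\<dots> \<le> c * (a y + rpow B p + 1)"
    using rpow_mono[of "\<bar>t\<bar>" B p] assms p_nonneg c_pos by simp
  finally show ?thesis .
qed

section \<open>Pointwise bounds and continuity of functions in the RKHS\<close>

lemma ip_sections: "x \<in> X \<Longrightarrow> x' \<in> X \<Longrightarrow> ip (kernel_section X k x) (kernel_section X k x') = k x x'"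
  by (simp add: reproducing section_mem) (simp add: kernel_section_def)

lemma hnorm_section: "x \<in> X \<Longrightarrow> hnorm ip (kernel_section X k x) = sqrt (k x x)"
  by (simp add: hnorm_def ip_sections)

lemma sqrt_kernel_le: "x \<in> X \<Longrightarrow> sqrt (k x x) \<le> \<kappa>"
  unfolding kernel_norm_def using bounded by (auto simp: bounded_kernel_def intro: cSUP_upper)

lemma kernel_norm_nonneg: "0 \<le> \<kappa>"
proof -
  obtain x where x: "x \<in> X" using nonempty by blast
  have "0 \<le> sqrt (k x x)"
    using hnorm_nonneg[OF section_mem[OF x]] by (simp only: hnorm_section[OF x])
  also have "\<dots> \<le> \<kappa>" by (rule sqrt_kernel_le[OF x])
  finally show ?thesis .
qed

text \<open>Cauchy-Schwarz applied to the reproducing property. Thus norm convergence in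
  \<open>H\<close> implies uniform convergence on \<open>X\<close>.\<close>

lemma abs_le:
  assumes "f \<in> H" "x \<in> X"
  shows "\<bar>f x\<bar> \<le> \<kappa> * hnorm ip f"
proof -
  have "\<bar>f x\<bar> \<le> hnorm ip f * sqrt (k x x)"
    using Cauchy_Schwarz[OF assms(1) section_mem[OF assms(2)]] assms
    by (simp add: reproducing hnorm_section)
  also have "\<dots> \<le> \<kappa> * hnorm ip f"
    using mult_right_mono[OF sqrt_kernel_le hnorm_nonneg] assms by (simp add: mult.commute)
  finally show ?thesis .
qed

text \<open>By the reproducing property and Cauchy-Schwarz, the increment of \<open>f\<close> is at
  most its norm times the distance between two kernel sections, which depends continuously on the
  points. Measurability of the composed loss rests on this.\<close>

lemma continuous_on_mem:
  assumes "f \<in> H"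
  shows "continuous_on X f"
  unfolding continuous_on_def
proof
  fix x assume x: "x \<in> X"
  \<comment> \<open>\<open>q x'\<close> is the squared distance in \<open>H\<close> between the
    kernel sections at \<open>x\<close> and \<open>x'\<close>; it vanishes at
    \<open>x' = x\<close>.\<close>
  define q where "q x' = k x x - 2 * k x x' + k x' x'" for x'
  have comp: "continuous_on X (\<lambda>x'. k (u x') (v x'))"
    if "continuous_on X u" "continuous_on X v" "u ` X \<subseteq> X" "v ` X \<subseteq> X" for u v
    using continuous_on_compose2[OF continuous continuous_on_Pair[OF that(1,2)]] that(3,4)
    by (auto simp: image_subset_iff)
  have "continuous_on X q"
    unfolding q_def using x by (intro continuous_intros comp) auto
  then have "continuous_on X (\<lambda>x'. hnorm ip f * sqrt (q x'))"
    by (intro continuous_intros)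
  then have lim: "((\<lambda>x'. hnorm ip f * sqrt (q x')) \<longlongrightarrow> 0) (at x within X)"
    using x unfolding continuous_on_def by (force simp: q_def)
  have bound: "\<bar>f x' - f x\<bar> \<le> hnorm ip f * sqrt (q x')" if "x' \<in> X" for x'
  proof -
    let ?K = "kernel_section X k"
    have "f x - f x' = ip f (\<lambda>z. ?K x z - ?K x' z)"
      using assms x that by (simp add: ip_diff_right reproducing section_mem)
    moreover have "(hnorm ip (\<lambda>z. ?K x z - ?K x' z))\<^sup>2 = q x'"
      using x that by (simp add: hnorm_diff_power2 section_mem ip_sections q_def)
    then have "hnorm ip (\<lambda>z. ?K x z - ?K x' z) = sqrt (q x')"
      using x that by (metis hnorm_nonneg diff_mem section_mem real_sqrt_unique)
    ultimately show ?thesis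
      using Cauchy_Schwarz[OF assms diff_mem[OF section_mem[OF x] section_mem[OF that]]]
      by (simp add: abs_minus_commute)
  qed
  have "((\<lambda>x'. f x' - f x) \<longlongrightarrow> 0) (at x within X)"
    by (rule Lim_null_comparison[OF _ lim]) (auto simp: eventually_at_filter bound)
  then show "(f \<longlongrightarrow> f x) (at x within X)" by (simp add: LIM_zero_iff)
qed

section \<open>Measurability and integrability of the loss\<close>

lemma mem_space:
  assumes "admissible Q" "z \<in> space Q"
  shows "fst z \<in> X" "snd z \<in> Y"
proof -
  have "sets Q = sets (restrict_space borel X \<Otimes>\<^sub>M restrict_space borel Y)"
    using assms by (simp add: admissible_def distribution_on_def)
  from sets_eq_imp_space_eq[OF this] have "space Q = X \<times> Y"
    by (simp add: space_pair_measure space_restrict_space)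
  then show "fst z \<in> X" "snd z \<in> Y" using assms(2) by (simp_all add: mem_Times_iff)
qed

lemma loss_comp_measurable:
  assumes "admissible Q" "f \<in> H"
  shows "(\<lambda>z. L (snd z) (f (fst z))) \<in> borel_measurable Q"
proof -
  have sets: "sets Q = sets (restrict_space borel X \<Otimes>\<^sub>M restrict_space borel Y)"
    using assms by (simp add: admissible_def distribution_on_def)
  have [measurable]: "f \<in> borel_measurable (restrict_space borel X)"
    by (rule borel_measurable_continuous_on_restrict[OF continuous_on_mem[OF assms(2)]])
  note loss_measurable[measurable]
  have "(\<lambda>z. (\<lambda>(y, t). L y t) (snd z, f (fst z)))
      \<in> borel_measurable (restrict_space borel X \<Otimes>\<^sub>M restrict_space borel Y)"
    by measurable
  then show ?thesis by (simp add: measurable_cong_sets[OF sets refl])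
qed

lemma a_integrable:
  assumes "admissible Q"
  shows "integrable Q (\<lambda>z. a (snd z))"
proof (rule integrableI_nonneg)
  have sets: "sets Q = sets (restrict_space borel X \<Otimes>\<^sub>M restrict_space borel Y)"
    using assms by (simp add: admissible_def distribution_on_def)
  note a_measurable[measurable]
  show "(\<lambda>z. a (snd z)) \<in> borel_measurable Q"
    unfolding measurable_cong_sets[OF sets refl] by measurable
  show "AE z in Q. 0 \<le> a (snd z)"
    using assms by (auto intro: AE_I2 a_nonneg mem_space)
  show "(\<integral>\<^sup>+z. ennreal (a (snd z)) \<partial>Q) < \<infinity>"
    using assms by (simp add: admissible_def abs_moment_def case_prod_unfold)
qed

lemma abs_moment_eq:
  assumes "admissible Q"
  shows "enn2real (abs_moment a Q) = (\<integral>z. a (snd z) \<partial>Q)"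
  unfolding abs_moment_def case_prod_unfold
  using assms by (intro integral_eq_nn_integral[symmetric])
    (auto intro!: AE_I2 a_nonneg mem_space borel_measurable_integrable a_integrable)

text \<open>The majorant from the type inequality. Its integral is explicit because constants
  integrate to themselves under a probability measure.\<close>

lemma bound_integrable:
  assumes "admissible Q"
  shows "integrable Q (\<lambda>z. c * (a (snd z) + s + 1))"
    and "(\<integral>z. c * (a (snd z) + s + 1) \<partial>Q) = c * (enn2real (abs_moment a Q) + s + 1)"
proof -
  interpret prob_space Q using assms by (simp add: admissible_def distribution_on_def)
  note a_integrable[OF assms, simp]
  show "integrable Q (\<lambda>z. c * (a (snd z) + s + 1))" by simp
  show "(\<integral>z. c * (a (snd z) + s + 1) \<partial>Q) = c * (enn2real (abs_moment a Q) + s + 1)"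
    by (simp add: abs_moment_eq[OF assms] prob_space)
qed

text \<open>Functions in \<open>H\<close> are bounded on \<open>X\<close>, so the type inequality
  dominates the loss by \<open>a\<close> plus a constant.\<close>

lemma loss_integrable:
  assumes "admissible Q" "f \<in> H"
  shows "integrable Q (\<lambda>z. L (snd z) (f (fst z)))"
proof (rule Bochner_Integration.integrable_bound)
  show "integrable Q (\<lambda>z. c * (a (snd z) + rpow (\<kappa> * hnorm ip f) p + 1))"
    by (rule bound_integrable[OF assms(1)])
  show "AE z in Q. norm (L (snd z) (f (fst z)))
      \<le> norm (c * (a (snd z) + rpow (\<kappa> * hnorm ip f) p + 1))"
  proof (rule AE_I2)
    fix z assume "z \<in> space Q"
    note z = mem_space[OF assms(1) this]
    show "norm (L (snd z) (f (fst z))) \<le> norm (c * (a (snd z) + rpow (\<kappa> * hnorm ip f) p + 1))"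
      using loss_nonneg[OF z(2)] loss_le[OF z(2) abs_le[OF assms(2) z(1)]] by simp
  qed
qed (rule loss_comp_measurable[OF assms])

lemma risk_eq:
  assumes "admissible Q" "f \<in> H"
  shows "risk L Q f = ennreal (real_risk Q f)" and "0 \<le> real_risk Q f"
proof -
  have AE: "AE z in Q. 0 \<le> L (snd z) (f (fst z))"
    using assms by (auto intro: AE_I2 loss_nonneg mem_space)
  show "risk L Q f = ennreal (real_risk Q f)"
    unfolding risk_def case_prod_unfold real_risk_def
    by (rule nn_integral_eq_integral[OF loss_integrable[OF assms] AE])
  show "0 \<le> real_risk Q f"
    unfolding real_risk_def by (rule integral_nonneg_AE[OF AE])
qed

lemma objective_nonneg: "admissible Q \<Longrightarrow> f \<in> H \<Longrightarrow> 0 \<le> objective Q f"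
  using risk_eq(2) l_pos by (simp add: objective_def)

lemma reg_risk_eq:
  assumes "admissible Q" "f \<in> H"
  shows "reg_risk L ip Q l f = ennreal (objective Q f)"
  using risk_eq[OF assms] l_pos by (simp add: reg_risk_def objective_def)

lemma real_risk_le:
  assumes "admissible Q" "f \<in> H"
  shows "real_risk Q f \<le> c * (enn2real (abs_moment a Q) + rpow (\<kappa> * hnorm ip f) p + 1)"
proof -
  have "real_risk Q f \<le> (\<integral>z. c * (a (snd z) + rpow (\<kappa> * hnorm ip f) p + 1) \<partial>Q)"
    unfolding real_risk_def
  proof (rule integral_mono[OF loss_integrable[OF assms] bound_integrable(1)[OF assms(1)]])
    fix z assume "z \<in> space Q"
    note z = mem_space[OF assms(1) this]
    show "L (snd z) (f (fst z)) \<le> c * (a (snd z) + rpow (\<kappa> * hnorm ip f) p + 1)"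
      by (rule loss_le[OF z(2) abs_le[OF assms(2) z(1)]])
  qed
  then show ?thesis unfolding bound_integrable(2)[OF assms(1)] .
qed

section \<open>Convexity and continuity of the objective, its minimizer, and differences of
  risks\<close>

lemma real_risk_midpoint:
  assumes "admissible Q" "f \<in> H" "g \<in> H"
  shows "real_risk Q (\<lambda>x. (f x + g x) / 2) \<le> (real_risk Q f + real_risk Q g) / 2"
proof -
  note int = loss_integrable[OF assms(1,2)] loss_integrable[OF assms(1,3)]
  have "real_risk Q (\<lambda>x. (f x + g x) / 2)
      \<le> (\<integral>z. (L (snd z) (f (fst z)) + L (snd z) (g (fst z))) / 2 \<partial>Q)"
    unfolding real_risk_def
  proof (rule integral_mono)
    fix z assume "z \<in> space Q"
    then have "convex_on UNIV (L (snd z))" using loss_convex mem_space[OF assms(1)] by blast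
    from convex_onD[OF this, of "1/2" "f (fst z)" "g (fst z)"]
    show "L (snd z) ((f (fst z) + g (fst z)) / 2) \<le> (L (snd z) (f (fst z)) + L (snd z) (g (fst z))) / 2"
      by (simp add: field_simps)
  next
    show "integrable Q (\<lambda>z. (L (snd z) (f (fst z)) + L (snd z) (g (fst z))) / 2)"
      using int by simp
  qed (rule loss_integrable[OF assms(1) midpoint_mem[OF assms(2,3)]])
  also have "\<dots> = (real_risk Q f + real_risk Q g) / 2"
    unfolding real_risk_def using int by simp
  finally show ?thesis .
qed

lemma objective_midpoint:
  assumes "admissible Q" "f \<in> H" "g \<in> H"
  shows "objective Q (\<lambda>x. (f x + g x) / 2)
    \<le> (objective Q f + objective Q g) / 2 - l / 4 * (hnorm ip (\<lambda>x. f x - g x))\<^sup>2"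
proof -
  have "l * (hnorm ip (\<lambda>x. (f x + g x) / 2))\<^sup>2
      = (l * (hnorm ip f)\<^sup>2 + l * (hnorm ip g)\<^sup>2) / 2 - l / 4 * (hnorm ip (\<lambda>x. f x - g x))\<^sup>2"
    unfolding hnorm_midpoint_power2[OF assms(2,3)] by (simp add: field_simps)
  then show ?thesis
    using real_risk_midpoint[OF assms] unfolding objective_def by argo
qed

text \<open>Dominated convergence: norm convergence gives pointwise convergence, and a finite convex
  function on the real line is continuous.\<close>

lemma objective_tendsto:
  assumes "admissible Q" "\<And>n. F n \<in> H" "f \<in> H"
    and lim: "(\<lambda>n. hnorm ip (\<lambda>x. F n x - f x)) \<longlonglongrightarrow> 0"
  shows "(\<lambda>n. objective Q (F n)) \<longlonglongrightarrow> objective Q f"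
proof -
  have norm: "(\<lambda>n. hnorm ip (F n)) \<longlonglongrightarrow> hnorm ip f"
    using assms by (intro hnorm_tendsto)
  \<comment> \<open>A common norm bound yields one integrable majorant for the whole
    sequence.\<close>
  then obtain B where B: "\<And>n. hnorm ip (F n) \<le> B"
    using convergent_imp_Bseq[OF convergentI[OF norm]] unfolding Bseq_def
    by (metis abs_le_D1 real_norm_def)
  have "(\<lambda>n. real_risk Q (F n)) \<longlonglongrightarrow> real_risk Q f"
    unfolding real_risk_def
  proof (rule integral_dominated_convergence)
    show "integrable Q (\<lambda>z. c * (a (snd z) + rpow (\<kappa> * B) p + 1))"
      by (rule bound_integrable[OF assms(1)])
    show "AE z in Q. (\<lambda>n. L (snd z) (F n (fst z))) \<longlonglongrightarrow> L (snd z) (f (fst z))"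
    proof (rule AE_I2)
      fix z assume "z \<in> space Q"
      note z = mem_space[OF assms(1) this]
      have "(\<lambda>n. F n (fst z) - f (fst z)) \<longlonglongrightarrow> 0"
      proof (rule Lim_null_comparison)
        show "\<forall>\<^sub>F n in sequentially. norm (F n (fst z) - f (fst z))
            \<le> \<kappa> * hnorm ip (\<lambda>x. F n x - f x)"
          using abs_le[OF diff_mem[OF assms(2,3)] z(1)] by simp
        show "(\<lambda>n. \<kappa> * hnorm ip (\<lambda>x. F n x - f x)) \<longlonglongrightarrow> 0"
          using tendsto_mult_right_zero[OF lim] .
      qed
      then have "(\<lambda>n. F n (fst z)) \<longlonglongrightarrow> f (fst z)" by (simp add: LIM_zero_iff)
      moreover have "isCont (L (snd z)) (f (fst z))"
        using convex_on_continuous[OF open_UNIV loss_convex[OF z(2)]]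
        by (simp add: continuous_on_eq_continuous_at)
      ultimately show "(\<lambda>n. L (snd z) (F n (fst z))) \<longlonglongrightarrow> L (snd z) (f (fst z))"
        by (rule isCont_tendsto_compose[rotated])
    qed
    show "AE z in Q. norm (L (snd z) (F n (fst z))) \<le> c * (a (snd z) + rpow (\<kappa> * B) p + 1)" for n
    proof (rule AE_I2)
      fix z assume "z \<in> space Q"
      note z = mem_space[OF assms(1) this]
      have "\<bar>F n (fst z)\<bar> \<le> \<kappa> * B"
        using abs_le[OF assms(2) z(1)] mult_left_mono[OF B kernel_norm_nonneg] by (rule order_trans)
      then show "norm (L (snd z) (F n (fst z))) \<le> c * (a (snd z) + rpow (\<kappa> * B) p + 1)"
        using loss_le[OF z(2)] loss_nonneg[OF z(2)] by simp
    qed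
  qed (rule loss_comp_measurable[OF assms(1,3)] loss_comp_measurable[OF assms(1,2)])+
  then show ?thesis unfolding objective_def by (intro tendsto_intros norm)
qed

text \<open>On \<open>H\<close> the extended and the real objective agree, so their minimizers
  coincide; unique existence makes the definite description meaningful.\<close>

lemma is_arg_min_rrm_solution:
  assumes "admissible Q"
  shows "is_arg_min (objective Q) (\<lambda>f. f \<in> H) (rrm_solution L H ip Q l)"
proof -
  have "is_arg_min (reg_risk L ip Q l) (\<lambda>f. f \<in> H) f
      \<longleftrightarrow> is_arg_min (objective Q) (\<lambda>f. f \<in> H) f" for f
    using assms by (auto simp: is_arg_min_linorder reg_risk_eq ennreal_le_iff objective_nonneg)
  moreover have "\<exists>!f. is_arg_min (objective Q) (\<lambda>f. f \<in> H) f"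
    using assms by (intro strongly_convex_ex1_minimizer[OF l_pos]
        objective_nonneg objective_midpoint objective_tendsto)
  ultimately show ?thesis
    unfolding rrm_solution_def by (metis (no_types, lifting) ext theI')
qed

text \<open>The slope bound is integrated with \<open>B = \<kappa> * \<delta>\<close>, where
  \<open>M\<close> is the type majorant on twice that range. Only \<open>f\<close> has to be bounded
  by \<open>\<delta>\<close> in norm.\<close>

lemma real_risk_diff_ge:
  assumes "admissible Q" "f \<in> H" "g \<in> H" "0 < \<kappa>" "0 < \<delta>" "hnorm ip f \<le> \<delta>"
  shows "- (c * (enn2real (abs_moment a Q) + rpow (2 * (\<kappa> * \<delta>)) p + 1) / \<delta>
      * hnorm ip (\<lambda>x. f x - g x)) \<le> real_risk Q g - real_risk Q f"
proof -
  let ?d = "hnorm ip (\<lambda>x. f x - g x)"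
  let ?M = "\<lambda>z. c * (a (snd z) + rpow (2 * (\<kappa> * \<delta>)) p + 1)"
  note int = loss_integrable[OF assms(1,2)] loss_integrable[OF assms(1,3)]
    bound_integrable[OF assms(1)]
  have "(\<integral>z. - (?d / \<delta>) * ?M z \<partial>Q) \<le> (\<integral>z. L (snd z) (g (fst z)) - L (snd z) (f (fst z)) \<partial>Q)"
  proof (rule integral_mono)
    fix z assume "z \<in> space Q"
    note z = mem_space[OF assms(1) this]
    have M: "L (snd z) u \<le> ?M z" if "\<bar>u\<bar> \<le> 2 * (\<kappa> * \<delta>)" for u
      using loss_le[OF z(2) that] .
    then have "0 \<le> ?M z"
      using order_trans[OF loss_nonneg[OF z(2)] M[of 0]] assms(4,5) by simp
    have "\<bar>f (fst z)\<bar> \<le> \<kappa> * \<delta>"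
      using abs_le[OF assms(2) z(1)] mult_left_mono[OF assms(6) kernel_norm_nonneg] by (rule order_trans)
    then have "- (?M z / (\<kappa> * \<delta>) * \<bar>g (fst z) - f (fst z)\<bar>)
        \<le> L (snd z) (g (fst z)) - L (snd z) (f (fst z))"
      using assms(4,5) by (intro convex_on_diff_ge loss_convex loss_nonneg z M) auto
    \<comment> \<open>The increment is at most \<open>\<kappa>\<close> times the distance in
      \<open>H\<close>, which cancels the \<open>\<kappa>\<close> in the slope.\<close>
    moreover have "?M z / (\<kappa> * \<delta>) * \<bar>g (fst z) - f (fst z)\<bar> \<le> ?M z / (\<kappa> * \<delta>) * (\<kappa> * ?d)"
      using abs_le[OF diff_mem[OF assms(2,3)] z(1)] \<open>0 \<le> ?M z\<close> assms(4,5)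
      by (intro mult_left_mono) (auto simp: abs_minus_commute)
    moreover have "?M z / (\<kappa> * \<delta>) * (\<kappa> * ?d) = ?d / \<delta> * ?M z"
      using assms(4) by simp
    ultimately show "- (?d / \<delta>) * ?M z \<le> L (snd z) (g (fst z)) - L (snd z) (f (fst z))"
      by linarith
  next
    show "integrable Q (\<lambda>z. - (?d / \<delta>) * ?M z)"
      by (intro integrable_mult_right int)
    show "integrable Q (\<lambda>z. L (snd z) (g (fst z)) - L (snd z) (f (fst z)))"
      by (intro Bochner_Integration.integrable_diff int)
  qed
  also have "\<dots> = real_risk Q g - real_risk Q f"
    unfolding real_risk_def using int by simp
  also have "(\<integral>z. - (?d / \<delta>) * ?M z \<partial>Q) = - (?d / \<delta>) * (\<integral>z. ?M z \<partial>Q)"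
    by (rule integral_mult_right_zero)
  finally show ?thesis unfolding int(4) by (simp add: mult.commute)
qed

section \<open>Comparison of the minimizers under the original and the mixed distribution\<close>

lemma admissible_mixture:
  assumes "admissible P" "admissible Q" "0 \<le> \<epsilon>" "\<epsilon> \<le> 1"
  shows "admissible (mixture \<epsilon> P Q)"
proof -
  have sets: "sets P = sets Q"
    using assms by (simp add: admissible_def distribution_on_def)
  have "abs_moment a (mixture \<epsilon> P Q)
      = ennreal (1 - \<epsilon>) * abs_moment a P + ennreal \<epsilon> * abs_moment a Q"
    unfolding abs_moment_def case_prod_unfold
    using borel_measurable_integrable[OF a_integrable[OF assms(1)]]
    by (intro nn_integral_mixture[OF sets]) simp
  then show ?thesis
    using assms distribution_on_mixture[of X Y P Q \<epsilon>]
    by (simp add: admissible_def ennreal_mult_less_top)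
qed

text \<open>The weights sum to one, so the penalty splits along with the risk.\<close>

lemma objective_mixture:
  assumes "admissible P" "admissible Q" "f \<in> H" "0 \<le> \<epsilon>" "\<epsilon> \<le> 1"
  shows "objective (mixture \<epsilon> P Q) f = (1 - \<epsilon>) * objective P f + \<epsilon> * objective Q f"
proof -
  have sets: "sets P = sets Q"
    using assms by (simp add: admissible_def distribution_on_def)
  have "real_risk (mixture \<epsilon> P Q) f = (1 - \<epsilon>) * real_risk P f + \<epsilon> * real_risk Q f"
    unfolding real_risk_def
    by (rule integral_mixture[OF sets loss_integrable[OF assms(1,3)] loss_integrable[OF assms(2,3)]
          loss_nonneg[OF mem_space(2)[OF assms(1)]] assms(4,5)])
  then show ?thesis by (simp add: objective_def algebra_simps)
qed

lemma radius_power2: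
  assumes "admissible Q"
  shows "l * (radius L Q l)\<^sup>2 = real_risk Q (\<lambda>_. 0)"
  using risk_eq[OF assms zero_mem] l_pos by (simp add: radius_def)

text \<open>Comparison with the zero function: the penalty of the minimizer is at most the risk at
  zero, which is \<open>l\<close> times the squared radius.\<close>

lemma hnorm_rrm_solution_le:
  assumes "admissible Q"
  shows "hnorm ip (rrm_solution L H ip Q l) \<le> radius L Q l"
proof -
  let ?f = "rrm_solution L H ip Q l"
  have f: "?f \<in> H" "objective Q ?f \<le> objective Q (\<lambda>_. 0)"
    using is_arg_min_rrm_solution[OF assms] zero_mem unfolding is_arg_min_linorder by auto
  then have "l * (hnorm ip ?f)\<^sup>2 \<le> l * (radius L Q l)\<^sup>2"
    using risk_eq(2)[OF assms f(1)] by (simp add: objective_def hnorm_zero radius_power2[OF assms])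
  moreover have "0 \<le> radius L Q l"
    using l_pos by (simp add: radius_def)
  ultimately show ?thesis using l_pos by (simp add: power2_le_iff_abs_le)
qed

text \<open>Combining both gap inequalities leaves a quadratic in the distance \<open>d\<close>
  below a linear term of order \<open>\<epsilon>\<close>; one factor \<open>d\<close> then
  cancels.\<close>

lemma rrm_solution_mixture_bound:
  assumes P: "admissible P" and Q: "admissible Q"
    and \<delta>: "\<delta> = radius L P l" "0 < \<delta>" and \<epsilon>: "0 < \<epsilon>" "\<epsilon> \<le> 1" and "0 < \<kappa>"
    and f: "f = rrm_solution L H ip P l" and g: "g = rrm_solution L H ip (mixture \<epsilon> P Q) l"
  shows "l * \<delta> * hnorm ip (\<lambda>x. g x - f x)
    \<le> \<epsilon> * (c * (enn2real (abs_moment a Q) + rpow (2 * (\<kappa> * \<delta>)) p + 1)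
      + 2 * real_risk P (\<lambda>_. 0))"
proof -
  define d where "d = hnorm ip (\<lambda>x. g x - f x)"
  \<comment> \<open>\<open>C\<close> bounds the decrease of the risk under \<open>Q\<close> per unit
    of distance in \<open>H\<close>.\<close>
  define C where "C = c * (enn2real (abs_moment a Q) + rpow (2 * (\<kappa> * \<delta>)) p + 1) / \<delta>"
  have mix: "admissible (mixture \<epsilon> P Q)" using P Q \<epsilon> by (intro admissible_mixture) auto
  note minf = is_arg_min_rrm_solution[OF P, folded f]
  note ming = is_arg_min_rrm_solution[OF mix, folded g]
  have H: "f \<in> H" "g \<in> H" using minf ming by (auto simp: is_arg_min_def)
  have d_sym: "hnorm ip (\<lambda>x. f x - g x) = d"
  proof -
    have "(hnorm ip (\<lambda>x. f x - g x))\<^sup>2 = d\<^sup>2"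
      using H ip_commute[OF H] by (simp add: d_def hnorm_diff_power2)
    then show ?thesis
      unfolding d_def by (rule power2_eq_imp_eq) (intro hnorm_nonneg diff_mem H)+
  qed
  have d: "0 \<le> d" unfolding d_def using H by (intro hnorm_nonneg diff_mem)
  have f_le: "hnorm ip f \<le> \<delta>" using hnorm_rrm_solution_le[OF P] by (simp add: f \<delta>)
  have 1: "objective P f + l / 2 * d\<^sup>2 \<le> objective P g"
    using strongly_convex_minimizer_gap[OF objective_midpoint[OF P H] minf H(2)] by (simp add: d_sym)
  have "objective (mixture \<epsilon> P Q) g + l / 2 * d\<^sup>2 \<le> objective (mixture \<epsilon> P Q) f"
    using strongly_convex_minimizer_gap[OF objective_midpoint[OF mix H(2,1)] ming H(1)] by (simp add: d_def)
  then have 2: "l / 2 * d\<^sup>2 \<le> (1 - \<epsilon>) * (objective P f - objective P g)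
      + \<epsilon> * (objective Q f - objective Q g)"
    using objective_mixture[OF P Q] H \<epsilon> by (simp add: algebra_simps)
  have 3: "- (C * d) \<le> real_risk Q g - real_risk Q f"
    using real_risk_diff_ge[OF Q H \<open>0 < \<kappa>\<close> \<delta>(2) f_le] by (simp add: C_def d_sym)
  \<comment> \<open>Expanding around \<open>f\<close> uses only the norm bound on \<open>f\<close>
    and keeps the favourable term \<open>d\<^sup>2\<close>.\<close>
  have "(hnorm ip g)\<^sup>2 - (hnorm ip f)\<^sup>2 = d\<^sup>2 + 2 * ip f (\<lambda>x. g x - f x)"
    using H ip_commute[OF H] by (simp add: d_def hnorm_diff_power2 ip_diff_right hnorm_power2)
  moreover have "\<bar>ip f (\<lambda>x. g x - f x)\<bar> \<le> \<delta> * d"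
    using Cauchy_Schwarz[OF H(1) diff_mem[OF H(2,1)]] mult_right_mono[OF f_le d] by (simp add: d_def)
  ultimately have 4: "d\<^sup>2 - 2 * \<delta> * d \<le> (hnorm ip g)\<^sup>2 - (hnorm ip f)\<^sup>2" by linarith
  have "l * (d\<^sup>2 - 2 * \<delta> * d) \<le> l * ((hnorm ip g)\<^sup>2 - (hnorm ip f)\<^sup>2)"
    using 4 l_pos by (intro mult_left_mono) auto
  with 3 have 5: "objective Q f - objective Q g \<le> C * d + 2 * l * \<delta> * d - l * d\<^sup>2"
    unfolding objective_def by (simp add: algebra_simps)
  \<comment> \<open>Collected on the left, the coefficient of \<open>d\<^sup>2\<close> is
    \<open>l / 2 + (1 - \<epsilon>) * l / 2 + \<epsilon> * l\<close>, that is
    \<open>l + \<epsilon> * l / 2\<close>.\<close>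
  have "l / 2 * d\<^sup>2 \<le> (1 - \<epsilon>) * (- (l / 2 * d\<^sup>2)) + \<epsilon> * (C * d + 2 * l * \<delta> * d - l * d\<^sup>2)"
    using 1 2 \<epsilon> mult_left_mono[OF 5, of \<epsilon>]
      mult_left_mono[of "objective P f - objective P g" "- (l / 2 * d\<^sup>2)" "1 - \<epsilon>"]
    by linarith
  then have "l * d\<^sup>2 + \<epsilon> * (l * d\<^sup>2) / 2 \<le> \<epsilon> * (C + 2 * l * \<delta>) * d"
    by (simp add: algebra_simps) (simp add: field_simps)
  moreover have "0 \<le> \<epsilon> * (l * d\<^sup>2) / 2" using \<epsilon> l_pos by simp
  ultimately have "l * d * d \<le> \<epsilon> * (C + 2 * l * \<delta>) * d" by (simp add: power2_eq_square mult.assoc)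
  moreover have "0 \<le> C"
    using \<delta> c_pos by (simp add: C_def rpow_nonneg)
  \<comment> \<open>Cancelling \<open>d\<close> requires \<open>d\<close> to be nonzero; for
    \<open>d = 0\<close> the claim is nonnegativity of the right-hand side.\<close>
  ultimately have "l * d \<le> \<epsilon> * (C + 2 * l * \<delta>)"
    using d \<delta> \<epsilon> l_pos by (cases "d = 0") (auto simp: mult_le_cancel_right)
  then have "\<delta> * (l * d) \<le> \<delta> * (\<epsilon> * (C + 2 * l * \<delta>))"
    using \<delta> by (intro mult_left_mono) auto
  \<comment> \<open>The factor \<open>\<delta>\<close> clears the denominator of \<open>C\<close>
    and turns the penalty term into the risk at zero.\<close>
  also have "\<dots> = \<epsilon> * (\<delta> * C + 2 * (l * \<delta>\<^sup>2))"
    by (simp add: algebra_simps power2_eq_square)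
  also have "l * \<delta>\<^sup>2 = real_risk P (\<lambda>_. 0)"
    using radius_power2[OF P] by (simp add: \<delta>)
  also have "\<delta> * C = c * (enn2real (abs_moment a Q) + rpow (2 * (\<kappa> * \<delta>)) p + 1)"
    using \<delta> by (simp add: C_def)
  finally show ?thesis by (simp add: d_def algebra_simps)
qed

end

text \<open>The mixture bound is divided by \<open>l * \<delta>\<close> after the type inequality at
  \<open>t = 0\<close> has estimated the risk at zero. The case \<open>\<kappa> = 0\<close> is
  separate because the slope bound divides by \<open>\<kappa>\<close>.\<close>

theorem theorem16:
  fixes X :: "(real ^ 'd) set" and Y :: "real set"
    and L :: "real \<Rightarrow> real \<Rightarrow> real" and a :: "real \<Rightarrow> real" and p c :: real
    and P Pt :: "((real ^ 'd) \<times> real) measure"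
    and k :: "real ^ 'd \<Rightarrow> real ^ 'd \<Rightarrow> real"
    and H :: "(real ^ 'd \<Rightarrow> real) set"
    and ip :: "(real ^ 'd \<Rightarrow> real) \<Rightarrow> (real ^ 'd \<Rightarrow> real) \<Rightarrow> real"
    and \<epsilon> l :: real
  assumes "closed X" and "X \<noteq> {}" and "closed Y" and "Y \<noteq> {}"
    and "convex_loss Y L" and "loss_of_type Y L a p c"
    and "distribution_on X Y P" and "distribution_on X Y Pt"
    and "abs_moment a P < \<infinity>" and "abs_moment a Pt < \<infinity>"
    and "kernel_on X k" and "bounded_kernel X k"
    and "continuous_on (X \<times> X) (\<lambda>(x, x'). k x x')"
    and "rkhs X k H ip"
    and "0 < l" and "0 < radius L P l" and "0 < \<epsilon>" and "\<epsilon> \<le> 1"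
  shows "hnorm ip (\<lambda>x. rrm_solution L H ip (mixture \<epsilon> P Pt) l x - rrm_solution L H ip P l x)
    \<le> 2 * c * inverse (l * radius L P l) * \<epsilon> *
       (enn2real (abs_moment a P) + enn2real (abs_moment a Pt)
        + 2 powr (p + 1) * rpow (radius L P l) p * rpow (kernel_norm X k) p + 2)"
proof -
  interpret rkhs X k H ip by fact
  interpret kernel_risk X k H ip Y L a p c l
    by unfold_locales (use assms in auto)
  define \<delta> where "\<delta> = radius L P l"
  define f where "f = rrm_solution L H ip P l"
  define g where "g = rrm_solution L H ip (mixture \<epsilon> P Pt) l"
  define A where "A = enn2real (abs_moment a P)"
  define At where "At = enn2real (abs_moment a Pt)"
  define S where "S = A + At + 2 powr (p + 1) * rpow \<delta> p * rpow \<kappa> p + 2"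
  have P: "admissible P" and Pt: "admissible Pt"
    using assms by (auto simp: admissible_def)
  have \<delta>: "0 < \<delta>" using assms by (simp add: \<delta>_def)
  have A: "0 \<le> A" "0 \<le> At" by (simp_all add: A_def At_def)
  have "0 \<le> S" using A by (simp add: S_def rpow_nonneg)
  have bound: "l * \<delta> * hnorm ip (\<lambda>x. g x - f x) \<le> \<epsilon> * (2 * c * S)"
  proof (cases "\<kappa> = 0")
    case True
    have "admissible (mixture \<epsilon> P Pt)"
      using P Pt assms by (intro admissible_mixture) auto
    then have H: "f \<in> H" "g \<in> H"
      using is_arg_min_rrm_solution P by (auto simp: f_def g_def is_arg_min_def)
    \<comment> \<open>For \<open>\<kappa> = 0\<close> the space \<open>H\<close> contains only the
      zero function, so both minimizers coincide.\<close>
    have "h x = 0" if "h \<in> H" for h x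
      using abs_le[OF that, of x] vanish[OF that, of x] True by (cases "x \<in> X") auto
    then have "(\<lambda>x. g x - f x) = (\<lambda>_. 0)" using H by (intro ext) (metis diff_zero)
    then show ?thesis using \<open>0 \<le> S\<close> c_pos assms by (simp add: hnorm_zero)
  next
    case False
    then have \<kappa>: "0 < \<kappa>" using kernel_norm_nonneg by simp
    define R where "R = rpow (2 * (\<kappa> * \<delta>)) p"
    \<comment> \<open>Of the \<open>p + 1\<close> factors of two, \<open>p\<close> belong to the
      doubled range in \<open>R\<close>; one is left over.\<close>
    have "2 powr (p + 1) * rpow \<delta> p * rpow \<kappa> p = 2 * R"
      using \<delta> \<kappa> by (simp add: R_def rpow_def powr_mult powr_add)
    then have S: "S = A + At + 2 * R + 2" by (simp add: S_def)
    \<comment> \<open>For \<open>p = 0\<close> the term \<open>rpow 0 p\<close> is 1, but then \<open>R = 1\<close> as well.\<close>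
    have R: "2 * rpow 0 p \<le> 1 + 2 * R" "0 \<le> R" by (simp_all add: R_def rpow_def)
    have "real_risk P (\<lambda>_. 0) \<le> c * (A + rpow 0 p + 1)"
      using real_risk_le[OF P zero_mem] by (simp add: hnorm_zero A_def)
    then have "c * (At + R + 1) + 2 * real_risk P (\<lambda>_. 0)
        \<le> c * (At + R + 1 + 2 * (A + rpow 0 p + 1))"
      by (simp add: algebra_simps)
    also have "\<dots> \<le> c * (2 * S)"
    proof (rule mult_left_mono)
      \<comment> \<open>Once \<open>A\<close> and \<open>At\<close> are compared, what remains is
        \<open>2 * rpow 0 p + R + 3 \<le> 4 * R + 4\<close>.\<close>
      show "At + R + 1 + 2 * (A + rpow 0 p + 1) \<le> 2 * S"
        using A R by (simp add: S)
    qed (use c_pos in simp)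
    finally have "\<epsilon> * (c * (At + R + 1) + 2 * real_risk P (\<lambda>_. 0)) \<le> \<epsilon> * (2 * c * S)"
      using assms by (simp add: mult_ac)
    then show ?thesis
      using rrm_solution_mixture_bound[OF P Pt \<delta>_def \<delta> \<open>0 < \<epsilon>\<close> \<open>\<epsilon> \<le> 1\<close> \<kappa> f_def g_def]
      by (simp add: At_def R_def)
  qed
  have "hnorm ip (\<lambda>x. g x - f x) \<le> \<epsilon> * (2 * c * S) / (l * \<delta>)"
    using bound \<delta> l_pos by (simp add: pos_le_divide_eq mult_ac)
  also have "\<dots> = 2 * c * inverse (l * \<delta>) * \<epsilon> * S"
    by (simp add: divide_inverse mult_ac)
  finally show ?thesis
    unfolding S_def f_def g_def \<delta>_def A_def At_def .
qed

end
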